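(* Let $(R,\mathfrak m)$ be a Noetherian local domain, $V=\{v_1,\dots,v_N\}$ a finite set of divisorial valuations centered at $\mathfrak m$, $T$ a topological space, and $\{(\mathfrak a_\bullet(t),\mathfrak b_\bullet(t))\}_{t\in T}$ a family of pairs of filtrations of ideals in $R$. For $t\in T$ and $1\le i\le N$ put $\alpha_i(t):=v_i(\mathfrak a_\bullet(t))$ and $\beta_i(t):=v_i(\mathfrak b_\bullet(t))$, and assume $\alpha_i(t)\in[0,\infty)$ and $\beta_i(t)\in(0,\infty)$ for all $i$ and $t$. Assume that for each $t\in T$ $$\mathcal L_{\mathfrak b_\bullet(t)}(\mathfrak a_\bullet(t))=\max_{1\le i\le N}\frac{\alpha_i(t)}{\beta_i(t)},$$ and that each $\alpha_i$ and $\beta_i$ is continuous on $T$. Let $$\operatorname{Max}(\mathfrak a_\bullet(t),\mathfrak b_\bullet(t)):=\Bigl\{i\in\{1,\dots,N\}:\ \frac{\alpha_i(t)}{\beta_i(t)}=\max_{1\le k\le N}\frac{\alpha_k(t)}{\beta_k(t)}\Bigr\}.$$ Then $T$ admits a finite partition into locally closed strata, on each of which the maximizer set $\operatorname{Max}(\mathfrak a_\bullet(t),\mathfrak b_\bullet(t))$ is constant. In particular, on each stratum, the function $t\mapsto\mathcal L_{\mathfrak b_\bullet(t)}(\mathfrak a_\bullet(t))$ is given by a single ratio $\alpha_j(t)/\beta_j(t)$. Moreover, for each $j\in\{1,\dots,N\}$ the locus $$T_j^\circ:=\{t\in T:\operatorname{Max}(\mathfrak a_\bullet(t),\mathfrak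 b_\bullet(t))=\{j\}\}$$ is open in $T$.
   Context: A filtration is a family $\{\mathfrak a_p\}_{p\ge1}$ of proper ideals with $\mathfrak a_p\mathfrak a_{p'}\subseteq\mathfrak a_{p+p'}$ and $\mathfrak a_{p+1}\subseteq\mathfrak a_p$ for all $p,p'\ge1$. Algebraic Łojasiewicz exponent: $\mathcal L_{\mathfrak b_\bullet}(\mathfrak a_\bullet):=\inf\{\frac qp\in\mathbb Q_{>0}:\ \mathfrak b_{qt}\subseteq\overline{\mathfrak a_{pt}}\text{ for all integers }t\gg1\}\in\mathbb R_{\ge0}\cup\{\infty\}$, with $\inf\emptyset=\infty$, where $\overline I$ is the integral closure of $I$. For a valuation $v$ centered at $\mathfrak m$ (nonnegative on $R$, positive on $\mathfrak m$), $v(I):=\min\{v(x):x\in I\}$ and $v(\mathfrak a_\bullet):=\lim_{p\to\infty}\frac{v(\mathfrak a_p)}p=\inf_{p\ge1}\frac{v(\mathfrak a_p)}p$. *)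

theory Defs
  imports
    "HOL-Algebra.Algebra"
    "HOL-Analysis.Analysis"
    "HOL-Library.Disjoint_Sets"
begin

section \<open>Field of fractions of a domain\<close>

definition nz_pairs :: "('a, 'r) ring_scheme \<Rightarrow> ('a \<times> 'a) set" where
  "nz_pairs R = carrier R \<times> (carrier R - {\<zero>\<^bsub>R\<^esub>})"

definition frac_rel :: "('a, 'r) ring_scheme \<Rightarrow> (('a \<times> 'a) \<times> ('a \<times> 'a)) set" where
  "frac_rel R = {((a, b), (c, d)). (a, b) \<in> nz_pairs R \<and> (c, d) \<in> nz_pairs R \<and>
                                   a \<otimes>\<^bsub>R\<^esub> d = c \<otimes>\<^bsub>R\<^esub> b}"

definition fraction :: "('a, 'r) ring_scheme \<Rightarrow> 'a \<Rightarrow> 'a \<Rightarrow> ('a \<times> 'a) set" where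
  "fraction R a b = frac_rel R `` {(a, b)}"

definition Frac :: "('a, 'r) ring_scheme \<Rightarrow> ('a \<times> 'a) set ring" where
  "Frac R = \<lparr>carrier = nz_pairs R // frac_rel R,
     monoid.mult = (\<lambda>U V. \<Union>(a, b) \<in> U. \<Union>(c, d) \<in> V. fraction R (a \<otimes>\<^bsub>R\<^esub> c) (b \<otimes>\<^bsub>R\<^esub> d)),
     monoid.one = fraction R \<one>\<^bsub>R\<^esub> \<one>\<^bsub>R\<^esub>,
     ring.zero = fraction R \<zero>\<^bsub>R\<^esub> \<one>\<^bsub>R\<^esub>,
     ring.add = (\<lambda>U V. \<Union>(a, b) \<in> U. \<Union>(c, d) \<in> V.
              fraction R ((a \<otimes>\<^bsub>R\<^esub> d) \<oplus>\<^bsub>R\<^esub> (c \<otimes>\<^bsub>R\<^esub> b)) (b \<otimes>\<^bsub>R\<^esub> d))\<rparr>"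

definition to_Frac :: "('a, 'r) ring_scheme \<Rightarrow> 'a \<Rightarrow> ('a \<times> 'a) set" where
  "to_Frac R a = fraction R a \<one>\<^bsub>R\<^esub>"

context domain
begin

lemma equiv_frac_rel: "equiv (nz_pairs R) (frac_rel R)"
proof (rule equivI)
  show "frac_rel R \<subseteq> nz_pairs R \<times> nz_pairs R" by (auto simp: frac_rel_def)
  show "refl_on (nz_pairs R) (frac_rel R)" by (auto simp: refl_on_def frac_rel_def)
  show "sym (frac_rel R)" by (auto simp: sym_def frac_rel_def)
  show "trans (frac_rel R)"
  proof (rule transI, clarify)
    fix a b c d e f
    assume 1: "((a, b), (c, d)) \<in> frac_rel R" and 2: "((c, d), (e, f)) \<in> frac_rel R"
    from 1 2 have car: "a \<in> carrier R" "b \<in> carrier R" "c \<in> carrier R" "d \<in> carrier R"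
      "e \<in> carrier R" "f \<in> carrier R" and nz: "d \<noteq> \<zero>" and eq: "a \<otimes> d = c \<otimes> b" "c \<otimes> f = e \<otimes> d"
      by (auto simp: frac_rel_def nz_pairs_def)
    have "d \<otimes> (a \<otimes> f) = (a \<otimes> d) \<otimes> f" using car by (simp add: m_ac)
    also have "\<dots> = (c \<otimes> f) \<otimes> b" using car by (simp add: eq(1) m_ac)
    also have "\<dots> = d \<otimes> (e \<otimes> b)" using car by (simp add: eq(2) m_ac)
    finally have "a \<otimes> f = e \<otimes> b" using car nz by (simp add: m_lcancel)
    then show "((a, b), (e, f)) \<in> frac_rel R" using 1 2 by (auto simp: frac_rel_def)
  qed
qed

lemma frac_eq_iff:
  assumes "a \<in> carrier R" "b \<in> carrier R - {\<zero>}" "c \<in> carrier R" "d \<in> carrier R - {\<zero>}"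
  shows "fraction R a b = fraction R c d \<longleftrightarrow> a \<otimes> d = c \<otimes> b"
  unfolding fraction_def using assms
  by (subst eq_equiv_class_iff[OF equiv_frac_rel]) (auto simp: nz_pairs_def frac_rel_def)

lemma frac_carrier:
  assumes "a \<in> carrier R" "b \<in> carrier R - {\<zero>}"
  shows "fraction R a b \<in> carrier (Frac R)"
  using assms by (auto simp: Frac_def fraction_def nz_pairs_def intro!: quotientI)

lemma frac_cases:
  assumes "x \<in> carrier (Frac R)"
  obtains a b where "a \<in> carrier R" "b \<in> carrier R - {\<zero>}" "x = fraction R a b"
  using assms by (auto simp: Frac_def fraction_def nz_pairs_def elim!: quotientE)

lemma frac_memD:
  assumes "p \<in> fraction R a b" "a \<in> carrier R" "b \<in> carrier R - {\<zero>}"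
  shows "fst p \<in> carrier R" "snd p \<in> carrier R - {\<zero>}" "a \<otimes> snd p = fst p \<otimes> b"
  using assms by (auto simp: fraction_def frac_rel_def nz_pairs_def)

lemma frac_self: "a \<in> carrier R \<Longrightarrow> b \<in> carrier R - {\<zero>} \<Longrightarrow> (a, b) \<in> fraction R a b"
  by (auto simp: fraction_def frac_rel_def nz_pairs_def)

lemma nz_mult: "b \<in> carrier R - {\<zero>} \<Longrightarrow> d \<in> carrier R - {\<zero>} \<Longrightarrow> b \<otimes> d \<in> carrier R - {\<zero>}"
  by (auto simp: integral_iff)

lemma UN_UN_const:
  assumes "A \<noteq> {}" "B \<noteq> {}" "\<And>p q. p \<in> A \<Longrightarrow> q \<in> B \<Longrightarrow> f p q = c"
  shows "(\<Union>p\<in>A. \<Union>q\<in>B. f p q) = c"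
  using assms by auto

lemma frac_mult:
  assumes "a \<in> carrier R" "b \<in> carrier R - {\<zero>}" "c \<in> carrier R" "d \<in> carrier R - {\<zero>}"
  shows "fraction R a b \<otimes>\<^bsub>Frac R\<^esub> fraction R c d = fraction R (a \<otimes> c) (b \<otimes> d)"
    (is "_ = ?r")
proof -
  have "fraction R (fst p \<otimes> fst q) (snd p \<otimes> snd q) = fraction R (a \<otimes> c) (b \<otimes> d)"
    if "p \<in> fraction R a b" "q \<in> fraction R c d" for p q
  proof -
    note p = frac_memD[OF that(1) assms(1,2)] and q = frac_memD[OF that(2) assms(3,4)]
    have "(fst p \<otimes> fst q) \<otimes> (b \<otimes> d) = (fst p \<otimes> b) \<otimes> (fst q \<otimes> d)"
      using p(1,2) q(1,2) assms by (simp add: m_ac)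
    also have "\<dots> = (a \<otimes> snd p) \<otimes> (c \<otimes> snd q)" by (simp only: p(3) q(3))
    also have "\<dots> = (a \<otimes> c) \<otimes> (snd p \<otimes> snd q)"
      using p(1,2) q(1,2) assms by (simp add: m_ac)
    finally show ?thesis
      using p(1,2) q(1,2) assms by (subst frac_eq_iff) (auto simp: integral_iff)
  qed
  then have "(\<Union>p\<in>fraction R a b. \<Union>q\<in>fraction R c d.
      fraction R (fst p \<otimes> fst q) (snd p \<otimes> snd q)) = ?r"
    using frac_self[OF assms(1,2)] frac_self[OF assms(3,4)] by (intro UN_UN_const) auto
  then show ?thesis by (simp add: Frac_def case_prod_beta)
qed

lemma frac_add:
  assumes "a \<in> carrier R" "b \<in> carrier R - {\<zero>}" "c \<in> carrier R" "d \<in> carrier R - {\<zero>}"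
  shows "fraction R a b \<oplus>\<^bsub>Frac R\<^esub> fraction R c d = fraction R (a \<otimes> d \<oplus> c \<otimes> b) (b \<otimes> d)"
    (is "_ = ?r")
proof -
  have "fraction R (fst p \<otimes> snd q \<oplus> fst q \<otimes> snd p) (snd p \<otimes> snd q) = fraction R (a \<otimes> d \<oplus> c \<otimes> b) (b \<otimes> d)"
    if "p \<in> fraction R a b" "q \<in> fraction R c d" for p q
  proof -
    note p = frac_memD[OF that(1) assms(1,2)] and q = frac_memD[OF that(2) assms(3,4)]
    have "(fst p \<otimes> snd q \<oplus> fst q \<otimes> snd p) \<otimes> (b \<otimes> d)
        = (fst p \<otimes> b) \<otimes> (snd q \<otimes> d) \<oplus> (fst q \<otimes> d) \<otimes> (snd p \<otimes> b)"
      using p(1,2) q(1,2) assms by (simp add: m_ac l_distr r_distr)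
    also have "\<dots> = (a \<otimes> snd p) \<otimes> (snd q \<otimes> d) \<oplus> (c \<otimes> snd q) \<otimes> (snd p \<otimes> b)"
      by (simp only: p(3) q(3))
    also have "\<dots> = (a \<otimes> d \<oplus> c \<otimes> b) \<otimes> (snd p \<otimes> snd q)"
      using p(1,2) q(1,2) assms by (simp add: m_ac l_distr r_distr)
    finally show ?thesis
      using p(1,2) q(1,2) assms by (subst frac_eq_iff) (auto simp: integral_iff)
  qed
  then have "(\<Union>p\<in>fraction R a b. \<Union>q\<in>fraction R c d.
      fraction R (fst p \<otimes> snd q \<oplus> fst q \<otimes> snd p) (snd p \<otimes> snd q)) = ?r"
    using frac_self[OF assms(1,2)] frac_self[OF assms(3,4)] by (intro UN_UN_const) auto
  then show ?thesis by (simp add: Frac_def case_prod_beta)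
qed

lemma Frac_one: "\<one>\<^bsub>Frac R\<^esub> = fraction R \<one> \<one>" and Frac_zero: "\<zero>\<^bsub>Frac R\<^esub> = fraction R \<zero> \<one>"
  by (simp_all add: Frac_def)

lemma Frac_cring: "cring (Frac R)"
proof (rule cringI)
  show "abelian_group (Frac R)"
  proof (rule abelian_groupI)
    fix x y assume xy: "x \<in> carrier (Frac R)" "y \<in> carrier (Frac R)"
    obtain a b c d where r: "a \<in> carrier R" "b \<in> carrier R - {\<zero>}" "x = fraction R a b"
      "c \<in> carrier R" "d \<in> carrier R - {\<zero>}" "y = fraction R c d" using xy by (elim frac_cases) blast
    show "x \<oplus>\<^bsub>Frac R\<^esub> y \<in> carrier (Frac R)"
      using r by (simp add: frac_add frac_carrier nz_mult[simplified])
    show "x \<oplus>\<^bsub>Frac R\<^esub> y = y \<oplus>\<^bsub>Frac R\<^esub> x"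
      using r by (simp add: frac_add m_ac a_comm)
    fix z assume z: "z \<in> carrier (Frac R)"
    obtain e f where s: "e \<in> carrier R" "f \<in> carrier R - {\<zero>}" "z = fraction R e f"
      using z by (rule frac_cases)
    show "(x \<oplus>\<^bsub>Frac R\<^esub> y) \<oplus>\<^bsub>Frac R\<^esub> z = x \<oplus>\<^bsub>Frac R\<^esub> (y \<oplus>\<^bsub>Frac R\<^esub> z)"
      using r s by (simp add: frac_add nz_mult[simplified] m_ac l_distr r_distr a_ac)
  next
    show "\<zero>\<^bsub>Frac R\<^esub> \<in> carrier (Frac R)" by (simp add: Frac_zero frac_carrier)
  next
    fix x assume x: "x \<in> carrier (Frac R)"
    obtain a b where r: "a \<in> carrier R" "b \<in> carrier R - {\<zero>}" "x = fraction R a b"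
      using x by (rule frac_cases)
    show "\<zero>\<^bsub>Frac R\<^esub> \<oplus>\<^bsub>Frac R\<^esub> x = x" using r by (simp add: Frac_zero frac_add)
    have "fraction R (\<ominus> a) b \<oplus>\<^bsub>Frac R\<^esub> x = fraction R (\<ominus> a \<otimes> b \<oplus> a \<otimes> b) (b \<otimes> b)"
      using r by (simp add: frac_add)
    also have "\<ominus> a \<otimes> b \<oplus> a \<otimes> b = \<zero>" using r by (simp add: l_minus l_neg)
    also have "fraction R \<zero> (b \<otimes> b) = \<zero>\<^bsub>Frac R\<^esub>"
      using r by (simp add: Frac_zero frac_eq_iff nz_mult[simplified])
    finally show "\<exists>y\<in>carrier (Frac R). y \<oplus>\<^bsub>Frac R\<^esub> x = \<zero>\<^bsub>Frac R\<^esub>"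
      using r by (intro bexI[of _ "fraction R (\<ominus> a) b"]) (auto intro: frac_carrier)
  qed
next
  show "comm_monoid (Frac R)"
  proof (rule comm_monoidI)
    fix x y assume xy: "x \<in> carrier (Frac R)" "y \<in> carrier (Frac R)"
    obtain a b c d where r: "a \<in> carrier R" "b \<in> carrier R - {\<zero>}" "x = fraction R a b"
      "c \<in> carrier R" "d \<in> carrier R - {\<zero>}" "y = fraction R c d" using xy by (elim frac_cases) blast
    show "x \<otimes>\<^bsub>Frac R\<^esub> y \<in> carrier (Frac R)"
      using r by (simp add: frac_mult frac_carrier nz_mult[simplified])
    show "x \<otimes>\<^bsub>Frac R\<^esub> y = y \<otimes>\<^bsub>Frac R\<^esub> x"
      using r by (simp add: frac_mult m_ac)
    fix z assume z: "z \<in> carrier (Frac R)"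
    obtain e f where s: "e \<in> carrier R" "f \<in> carrier R - {\<zero>}" "z = fraction R e f"
      using z by (rule frac_cases)
    show "(x \<otimes>\<^bsub>Frac R\<^esub> y) \<otimes>\<^bsub>Frac R\<^esub> z = x \<otimes>\<^bsub>Frac R\<^esub> (y \<otimes>\<^bsub>Frac R\<^esub> z)"
      using r s by (simp add: frac_mult nz_mult[simplified] m_ac)
  next
    show "\<one>\<^bsub>Frac R\<^esub> \<in> carrier (Frac R)" by (simp add: Frac_one frac_carrier)
  next
    fix x assume x: "x \<in> carrier (Frac R)"
    then show "\<one>\<^bsub>Frac R\<^esub> \<otimes>\<^bsub>Frac R\<^esub> x = x"
      by (elim frac_cases) (simp add: Frac_one frac_mult)
  qed
next
  fix x y z assume xyz: "x \<in> carrier (Frac R)" "y \<in> carrier (Frac R)" "z \<in> carrier (Frac R)"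
  obtain a b c d e f where r: "a \<in> carrier R" "b \<in> carrier R - {\<zero>}" "x = fraction R a b"
      "c \<in> carrier R" "d \<in> carrier R - {\<zero>}" "y = fraction R c d"
      "e \<in> carrier R" "f \<in> carrier R - {\<zero>}" "z = fraction R e f" using xyz by (elim frac_cases) blast
  show "(x \<oplus>\<^bsub>Frac R\<^esub> y) \<otimes>\<^bsub>Frac R\<^esub> z = x \<otimes>\<^bsub>Frac R\<^esub> z \<oplus>\<^bsub>Frac R\<^esub> y \<otimes>\<^bsub>Frac R\<^esub> z"
  proof -
    have "(x \<oplus>\<^bsub>Frac R\<^esub> y) \<otimes>\<^bsub>Frac R\<^esub> z = fraction R ((a \<otimes> d \<oplus> c \<otimes> b) \<otimes> e) (b \<otimes> d \<otimes> f)"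
      using r by (simp add: frac_add frac_mult nz_mult[simplified])
    also have "\<dots> = fraction R (a \<otimes> e \<otimes> (d \<otimes> f) \<oplus> c \<otimes> e \<otimes> (b \<otimes> f)) (b \<otimes> f \<otimes> (d \<otimes> f))"
    proof (subst frac_eq_iff)
      show "(a \<otimes> d \<oplus> c \<otimes> b) \<otimes> e \<otimes> (b \<otimes> f \<otimes> (d \<otimes> f)) =
            (a \<otimes> e \<otimes> (d \<otimes> f) \<oplus> c \<otimes> e \<otimes> (b \<otimes> f)) \<otimes> (b \<otimes> d \<otimes> f)"
        using r(1,2,4,5,7,8) by (simp add: m_ac l_distr r_distr)
    qed (use r in \<open>auto simp: integral_iff\<close>)
    also have "\<dots> = x \<otimes>\<^bsub>Frac R\<^esub> z \<oplus>\<^bsub>Frac R\<^esub> y \<otimes>\<^bsub>Frac R\<^esub> z"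
      using r by (simp add: frac_add frac_mult nz_mult[simplified])
    finally show ?thesis .
  qed
qed

lemma Frac_field: "field (Frac R)"
proof (rule cring.cring_fieldI2[OF Frac_cring])
  show "\<zero>\<^bsub>Frac R\<^esub> \<noteq> \<one>\<^bsub>Frac R\<^esub>" by (simp add: Frac_one Frac_zero frac_eq_iff)
next
  fix x assume x: "x \<in> carrier (Frac R)" "x \<noteq> \<zero>\<^bsub>Frac R\<^esub>"
  obtain a b where r: "a \<in> carrier R" "b \<in> carrier R - {\<zero>}" "x = fraction R a b"
    using x(1) by (rule frac_cases)
  have "a \<noteq> \<zero>" using x(2) r by (auto simp: Frac_zero frac_eq_iff)
  then show "\<exists>y\<in>carrier (Frac R). x \<otimes>\<^bsub>Frac R\<^esub> y = \<one>\<^bsub>Frac R\<^esub>"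
    using r by (intro bexI[of _ "fraction R b a"])
      (auto simp: frac_mult Frac_one frac_eq_iff nz_mult[simplified] integral_iff m_ac intro!: frac_carrier)
qed

lemma to_Frac_hom: "to_Frac R \<in> ring_hom R (Frac R)"
  by (rule ring_hom_memI)
    (auto simp: to_Frac_def frac_carrier frac_mult frac_add Frac_one)

lemma to_Frac_inj: "inj_on (to_Frac R) (carrier R)"
  by (auto simp: inj_on_def to_Frac_def frac_eq_iff)

end


section \<open>Local rings, height, integral closure\<close>

definition local_ring :: "('a, 'r) ring_scheme \<Rightarrow> 'a set \<Rightarrow> bool" where
  "local_ring R m \<longleftrightarrow> cring R \<and> maximalideal m R \<and> (\<forall>n. maximalideal n R \<longrightarrow> n = m)"

definition ideal_height :: "('a, 'r) ring_scheme \<Rightarrow> 'a set \<Rightarrow> enat" where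
  "ideal_height R p = Sup {enat n |n. \<exists>P :: nat \<Rightarrow> 'a set.
     (\<forall>i\<le>n. primeideal (P i) R) \<and> (\<forall>i<n. P i \<subset> P (Suc i)) \<and> P n = p}"

fun ideal_power :: "('a, 'r) ring_scheme \<Rightarrow> 'a set \<Rightarrow> nat \<Rightarrow> 'a set" where
  "ideal_power R I 0 = carrier R"
| "ideal_power R I (Suc n) = ideal_prod R I (ideal_power R I n)"

definition integral_closure :: "('a, 'r) ring_scheme \<Rightarrow> 'a set \<Rightarrow> 'a set" where
  "integral_closure R I = {x \<in> carrier R. \<exists>n\<ge>1. \<exists>c :: nat \<Rightarrow> 'a.
     (\<forall>i\<in>{1..n}. c i \<in> ideal_power R I i) \<and>
     (x [^]\<^bsub>R\<^esub> n) \<oplus>\<^bsub>R\<^esub> (\<Oplus>\<^bsub>R\<^esub>i\<in>{1..n}. c i \<otimes>\<^bsub>R\<^esub> (x [^]\<^bsub>R\<^esub> (n - i))) = \<zero>\<^bsub>R\<^esub>}"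


section \<open>Transcendence degree\<close>

text \<open>A polynomial over \<open>k\<close> in the variables \<open>S\<close> is given by a finite set \<open>F\<close> of exponent
  vectors and its coefficients \<open>c\<close>. Exponent vectors are extensional functions, so that
  distinct elements of \<open>F\<close> are distinct monomials.\<close>

definition alg_independent :: "('k, 'r) ring_scheme \<Rightarrow> 'k set \<Rightarrow> 'k set \<Rightarrow> bool" where
  "alg_independent L k S \<longleftrightarrow> S \<subseteq> carrier L \<and>
     (\<forall>F c. finite F \<longrightarrow> F \<subseteq> (S \<rightarrow>\<^sub>E (UNIV :: nat set)) \<longrightarrow> c \<in> F \<rightarrow> k \<longrightarrow>
        (\<Oplus>\<^bsub>L\<^esub>e\<in>F. c e \<otimes>\<^bsub>L\<^esub> (\<Otimes>\<^bsub>L\<^esub>s\<in>S. s [^]\<^bsub>L\<^esub> (e s))) = \<zero>\<^bsub>L\<^esub> \<longrightarrow>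
        (\<forall>e\<in>F. c e = \<zero>\<^bsub>L\<^esub>))"

definition trdeg :: "('k, 'r) ring_scheme \<Rightarrow> 'k set \<Rightarrow> enat" where
  "trdeg L k = Sup {enat (card S) |S. finite S \<and> alg_independent L k S}"


section \<open>Divisorial valuations\<close>

definition valuation :: "('k, 'r) ring_scheme \<Rightarrow> ('k \<Rightarrow> ereal) \<Rightarrow> bool" where
  "valuation K v \<longleftrightarrow>
     (\<forall>x\<in>carrier K. v x \<noteq> -\<infinity> \<and> (v x = \<infinity> \<longleftrightarrow> x = \<zero>\<^bsub>K\<^esub>)) \<and>
     (\<forall>x\<in>carrier K. \<forall>y\<in>carrier K. v (x \<otimes>\<^bsub>K\<^esub> y) = v x + v y) \<and>
     (\<forall>x\<in>carrier K. \<forall>y\<in>carrier K. min (v x) (v y) \<le> v (x \<oplus>\<^bsub>K\<^esub> y))"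

definition valuation_ring :: "('k, 'r) ring_scheme \<Rightarrow> ('k \<Rightarrow> ereal) \<Rightarrow> ('k, 'r) ring_scheme" where
  "valuation_ring K v = K\<lparr>carrier := {x \<in> carrier K. 0 \<le> v x}\<rparr>"

definition valuation_ideal :: "('k, 'r) ring_scheme \<Rightarrow> ('k \<Rightarrow> ereal) \<Rightarrow> 'k set" where
  "valuation_ideal K v = {x \<in> carrier K. 0 < v x}"

definition residue_field :: "('k, 'r) ring_scheme \<Rightarrow> ('k \<Rightarrow> ereal) \<Rightarrow> 'k set ring" where
  "residue_field K v = valuation_ring K v Quot valuation_ideal K v"

definition centered_valuation ::
  "('a, 'r) ring_scheme \<Rightarrow> 'a set \<Rightarrow> (('a \<times> 'a) set \<Rightarrow> ereal) \<Rightarrow> bool" where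
  "centered_valuation R m v \<longleftrightarrow> valuation (Frac R) v \<and>
     (\<forall>x\<in>carrier R. 0 \<le> v (to_Frac R x)) \<and> (\<forall>x\<in>m. 0 < v (to_Frac R x))"

text \<open>The copy of \<open>R/m\<close> inside the residue field of a valuation centered at \<open>m\<close>.\<close>

definition base_residue_field ::
  "('a, 'r) ring_scheme \<Rightarrow> (('a \<times> 'a) set \<Rightarrow> ereal) \<Rightarrow> ('a \<times> 'a) set set set" where
  "base_residue_field R v =
     (\<lambda>x. valuation_ideal (Frac R) v +>\<^bsub>valuation_ring (Frac R) v\<^esub> to_Frac R x) ` carrier R"

text \<open>The residue field of \<open>v\<close> has transcendence degree \<open>ht m - 1\<close> over \<open>R/m\<close>; for a
  Noetherian local domain this forces \<open>v\<close> to be discrete. The value group is not normalized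
  to be the integers, so positive multiples of a divisorial valuation are divisorial.\<close>

definition divisorial_valuation ::
  "('a, 'r) ring_scheme \<Rightarrow> 'a set \<Rightarrow> (('a \<times> 'a) set \<Rightarrow> ereal) \<Rightarrow> bool" where
  "divisorial_valuation R m v \<longleftrightarrow> centered_valuation R m v \<and>
     trdeg (residue_field (Frac R) v) (base_residue_field R v) + 1 = ideal_height R m"


section \<open>Filtrations and the Lojasiewicz exponent\<close>

text \<open>Only the members with positive index belong to a filtration; \<open>a 0\<close> is irrelevant.\<close>

definition filtration :: "('a, 'r) ring_scheme \<Rightarrow> (nat \<Rightarrow> 'a set) \<Rightarrow> bool" where
  "filtration R a \<longleftrightarrow>
     (\<forall>p\<ge>1. ideal (a p) R \<and> a p \<noteq> carrier R) \<and>
     (\<forall>p\<ge>1. \<forall>p'\<ge>1. ideal_prod R (a p) (a p') \<subseteq> a (p + p')) \<and>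
     (\<forall>p\<ge>1. a (p + 1) \<subseteq> a p)"

definition lojasiewicz_exponent ::
  "('a, 'r) ring_scheme \<Rightarrow> (nat \<Rightarrow> 'a set) \<Rightarrow> (nat \<Rightarrow> 'a set) \<Rightarrow> ereal" where
  "lojasiewicz_exponent R b a = Inf {ereal (real q / real p) |q p. 1 \<le> q \<and> 1 \<le> p \<and>
     (\<forall>\<^sub>F t in sequentially. b (q * t) \<subseteq> integral_closure R (a (p * t)))}"

text \<open>For divisorial valuations the infimum is attained, as they are discrete.\<close>

definition ideal_value ::
  "('a, 'r) ring_scheme \<Rightarrow> (('a \<times> 'a) set \<Rightarrow> ereal) \<Rightarrow> 'a set \<Rightarrow> ereal" where
  "ideal_value R v I = (INF x\<in>I. v (to_Frac R x))"

definition filtration_value ::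
  "('a, 'r) ring_scheme \<Rightarrow> (('a \<times> 'a) set \<Rightarrow> ereal) \<Rightarrow> (nat \<Rightarrow> 'a set) \<Rightarrow> ereal" where
  "filtration_value R v a = lim (\<lambda>p. ideal_value R v (a p) / ereal (real p))"

definition max_set ::
  "('a, 'r) ring_scheme \<Rightarrow> nat \<Rightarrow> (nat \<Rightarrow> ('a \<times> 'a) set \<Rightarrow> ereal) \<Rightarrow>
   (nat \<Rightarrow> 'a set) \<Rightarrow> (nat \<Rightarrow> 'a set) \<Rightarrow> nat set" where
  "max_set R N v a b = {i \<in> {1..N}.
     filtration_value R (v i) a / filtration_value R (v i) b =
       (MAX k\<in>{1..N}. filtration_value R (v k) a / filtration_value R (v k) b)}"


section \<open>Locally closed sets\<close>

definition locally_closedin :: "'t topology \<Rightarrow> 't set \<Rightarrow> bool" where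
  "locally_closedin T S \<longleftrightarrow> (\<exists>U C. openin T U \<and> closedin T C \<and> S = U \<inter> C)"

end

theory Submission
  imports Defs
begin

text \<open>The locus where a given nonempty set \<open>J\<close> of indices is the maximizer set is cut out by the closed
  conditions \<open>r k \<le> r i\<close> and the open conditions \<open>r l < r i\<close> for \<open>i \<in> J\<close> and \<open>l \<notin> J\<close>. There are finitely
  many \<open>J\<close>; for \<open>J = {j}\<close> the closed conditions follow from the open ones.\<close>

text \<open>\<open>max_set\<close> is the instance where \<open>r\<close> lists the ratios of
  filtration values. Over an arbitrary linear order the stratification becomes pure order and
  topology.\<close>

definition argmax_set :: "'i set \<Rightarrow> ('i \<Rightarrow> 'b::linorder) \<Rightarrow> 'i set" where
  "argmax_set I r = {i \<in> I. r i = (MAX k\<in>I. r k)}"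

lemma in_argmax_set_iff:
  assumes "finite I"
  shows "i \<in> argmax_set I r \<longleftrightarrow> i \<in> I \<and> (\<forall>k\<in>I. r k \<le> r i)"
proof (cases "i \<in> I")
  case True
  then have "(MAX k\<in>I. r k) = r i \<longleftrightarrow> (\<forall>k\<in>I. r k \<le> r i)"
    using assms by (subst Max_eq_iff) auto
  with True show ?thesis
    by (auto simp: argmax_set_def)
qed (simp add: argmax_set_def)

lemma argmax_set_nonempty:
  assumes "finite I" "I \<noteq> {}"
  shows "argmax_set I r \<noteq> {}"
proof -
  have "(MAX k\<in>I. r k) \<in> r ` I"
    using assms by (intro Max_in) auto
  then show ?thesis
    by (auto simp: argmax_set_def)
qed

text \<open>The weak inequalities over \<open>J \<times> I\<close> include
  \<open>J \<times> J\<close>, so they force ties inside \<open>J\<close> and make each member a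
  maximizer; the strict ones keep all other indices out. For empty \<open>J\<close> the right-hand
  side would be vacuously true.\<close>

lemma argmax_set_eq_iff:
  assumes "finite I" "J \<subseteq> I" "J \<noteq> {}"
  shows "argmax_set I r = J \<longleftrightarrow>
    (\<forall>(i, k)\<in>J \<times> (I - J). r k < r i) \<and> (\<forall>(i, k)\<in>J \<times> I. r k \<le> r i)"
    (is "_ \<longleftrightarrow> ?lt \<and> ?le")
proof
  assume eq: "argmax_set I r = J"
  have le: "r k \<le> r i" if "i \<in> J" "k \<in> I" for i k
    using that assms(1) by (auto simp: in_argmax_set_iff simp flip: eq)
  have lt: "r k < r i" if "i \<in> J" "k \<in> I - J" for i k
  proof (rule ccontr)
    \<comment> \<open>An outside index that is not strictly below the maximizer \<open>i\<close>
      dominates everything that \<open>i\<close> dominates, hence is a maximizer itself.\<close>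
    assume "\<not> r k < r i"
    with le[OF that(1)] have "\<forall>l\<in>I. r l \<le> r k"
      using order_trans by (metis not_less)
    with that(2) assms(1) have "k \<in> argmax_set I r"
      by (simp add: in_argmax_set_iff)
    with that(2) eq show False by simp
  qed
  from le lt show "?lt \<and> ?le" by auto
next
  assume "?lt \<and> ?le"
  with assms show "argmax_set I r = J"
    by (fastforce simp: in_argmax_set_iff)
qed

lemma argmax_set_eq_singleton_iff:
  assumes "finite I" "j \<in> I"
  shows "argmax_set I r = {j} \<longleftrightarrow> (\<forall>k\<in>I - {j}. r k < r j)"
  using assms by (subst argmax_set_eq_iff) (auto intro: less_imp_le)

context
  fixes T :: "'t topology" and f g :: "'t \<Rightarrow> 'b::linorder_topology"
  assumes cont: "continuous_map T euclidean f" "continuous_map T euclidean g"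
begin

text \<open>The locus is the preimage of the open strict subdiagonal under the pairing of
  \<open>f\<close> and \<open>g\<close>. This avoids the difference of \<open>f\<close> and
  \<open>g\<close>, so it works in any order topology, in particular for
  \<open>ereal\<close>.\<close>

lemma openin_less_continuous_map: "openin T {t \<in> topspace T. f t < g t}"
proof -
  have "continuous_map T euclidean (\<lambda>t. (f t, g t))"
    using continuous_map_pairedI[OF cont] by simp
  from openin_continuous_map_preimage[OF this, of "{(x, y) |x y. x < y}"]
  show ?thesis
    using open_subdiagonal by simp
qed

lemma closedin_le_continuous_map: "closedin T {t \<in> topspace T. f t \<le> g t}"
proof -
  have "continuous_map T euclidean (\<lambda>t. (f t, g t))"
    using continuous_map_pairedI[OF cont] by simp
  from closedin_continuous_map_preimage[OF this, of "{(x, y) |x y. x \<le> y}"]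
  show ?thesis
    using closed_subdiagonal by simp
qed

end

text \<open>A finite numerator and a nonzero denominator exclude the quotients
  \<open>\<infinity> / \<infinity>\<close> and those by \<open>0\<close>, where division on
  \<open>ereal\<close> fails to be continuous.\<close>

lemma continuous_map_divide_ereal:
  fixes f g :: "'t \<Rightarrow> ereal"
  assumes "continuous_map T euclidean f" "continuous_map T euclidean g"
    and "\<And>t. t \<in> topspace T \<Longrightarrow> \<bar>f t\<bar> \<noteq> \<infinity>"
    and "\<And>t. t \<in> topspace T \<Longrightarrow> g t \<noteq> 0"
  shows "continuous_map T euclidean (\<lambda>t. f t / g t)"
  unfolding continuous_map_atin
proof
  fix t assume "t \<in> topspace T"
  with assms have "((\<lambda>t. f t / g t) \<longlongrightarrow> f t / g t) (atin T t)"
    by (intro tendsto_divide_ereal) (auto simp: continuous_map_atin)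
  then show "limitin euclidean (\<lambda>t. f t / g t) (f t / g t) (atin T t)"
    by simp
qed

lemma openin_Ball_finite:
  assumes "finite A" "\<And>x. x \<in> A \<Longrightarrow> openin T {t \<in> topspace T. P x t}"
  shows "openin T {t \<in> topspace T. \<forall>x\<in>A. P x t}"
proof -
  \<comment> \<open>The factor \<open>topspace T\<close> matters for empty \<open>A\<close>, where
    the bare intersection is \<open>UNIV\<close>.\<close>
  have "{t \<in> topspace T. \<forall>x\<in>A. P x t} = (\<Inter>x\<in>A. {t \<in> topspace T. P x t}) \<inter> topspace T"
    by auto
  with openin_INT[OF assms] show ?thesis by simp
qed

lemma closedin_Ball:
  assumes "\<And>x. x \<in> A \<Longrightarrow> closedin T {t \<in> topspace T. P x t}"
  shows "closedin T {t \<in> topspace T. \<forall>x\<in>A. P x t}"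
\<comment> \<open>An empty intersection would be \<open>UNIV\<close>; in that case the set is all of
  \<open>topspace T\<close>, which is closed.\<close>
proof (cases "A = {}")
  case False
  then have "{t \<in> topspace T. \<forall>x\<in>A. P x t} = (\<Inter>x\<in>A. {t \<in> topspace T. P x t})"
    by auto
  with closedin_INT[OF False assms] show ?thesis by simp
qed simp

context
  fixes T :: "'t topology" and I :: "'i set" and r :: "'i \<Rightarrow> 't \<Rightarrow> 'b::linorder_topology"
  assumes fin: "finite I" and cont: "\<And>i. i \<in> I \<Longrightarrow> continuous_map T euclidean (r i)"
begin

lemma openin_argmax_set_eq_singleton:
  assumes "j \<in> I"
  shows "openin T {t \<in> topspace T. argmax_set I (\<lambda>i. r i t) = {j}}"
  unfolding argmax_set_eq_singleton_iff[OF fin assms]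
  using fin cont assms by (intro openin_Ball_finite openin_less_continuous_map) auto

lemma locally_closedin_argmax_set_eq:
  assumes "J \<subseteq> I" "J \<noteq> {}"
  shows "locally_closedin T {t \<in> topspace T. argmax_set I (\<lambda>i. r i t) = J}"
proof -
  let ?U = "{t \<in> topspace T. \<forall>x\<in>J \<times> (I - J). r (snd x) t < r (fst x) t}"
  let ?C = "{t \<in> topspace T. \<forall>x\<in>J \<times> I. r (snd x) t \<le> r (fst x) t}"
  have "openin T ?U"
    using assms fin cont
    by (intro openin_Ball_finite openin_less_continuous_map) (auto intro: finite_subset)
  moreover have "closedin T ?C"
    using assms cont by (intro closedin_Ball closedin_le_continuous_map) auto
  moreover have "{t \<in> topspace T. argmax_set I (\<lambda>i. r i t) = J} = ?U \<inter> ?C"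
    unfolding argmax_set_eq_iff[OF fin assms] by (auto simp: case_prod_unfold)
  ultimately show ?thesis
    unfolding locally_closedin_def by blast
qed

end

text \<open>Indexing the blocks by attained values only ensures that none of them is empty.\<close>

lemma partition_on_fibers: "partition_on A ((\<lambda>y. {x \<in> A. f x = y}) ` f ` A)"
  by (rule partition_onI) (auto simp: disjnt_def)

theorem theorem9p9:
  fixes R :: "('a, 'r) ring_scheme" and m :: "'a set"
    and N :: nat and v :: "nat \<Rightarrow> ('a \<times> 'a) set \<Rightarrow> ereal"
    and T :: "'t topology" and a b :: "'t \<Rightarrow> nat \<Rightarrow> 'a set"
    and \<alpha> \<beta> :: "nat \<Rightarrow> 't \<Rightarrow> ereal"
  assumes "noetherian_domain R" and "local_ring R m"
    and "1 \<le> N"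
    and "\<And>i. i \<in> {1..N} \<Longrightarrow> divisorial_valuation R m (v i)"
    and "\<And>t. t \<in> topspace T \<Longrightarrow> filtration R (a t)"
    and "\<And>t. t \<in> topspace T \<Longrightarrow> filtration R (b t)"
    and "\<And>i t. \<alpha> i t = filtration_value R (v i) (a t)"
    and "\<And>i t. \<beta> i t = filtration_value R (v i) (b t)"
    and "\<And>i t. i \<in> {1..N} \<Longrightarrow> t \<in> topspace T \<Longrightarrow> 0 \<le> \<alpha> i t \<and> \<alpha> i t < \<infinity>"
    and "\<And>i t. i \<in> {1..N} \<Longrightarrow> t \<in> topspace T \<Longrightarrow> 0 < \<beta> i t \<and> \<beta> i t < \<infinity>"
    and "\<And>t. t \<in> topspace T \<Longrightarrow>
           lojasiewicz_exponent R (b t) (a t) = (MAX i\<in>{1..N}. \<alpha> i t / \<beta> i t)"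
    and "\<And>i. i \<in> {1..N} \<Longrightarrow> continuous_map T euclidean (\<alpha> i)"
    and "\<And>i. i \<in> {1..N} \<Longrightarrow> continuous_map T euclidean (\<beta> i)"
  shows "(\<exists>P. finite P \<and> partition_on (topspace T) P \<and>
            (\<forall>S\<in>P. locally_closedin T S \<and>
                   (\<lambda>t. max_set R N v (a t) (b t)) constant_on S \<and>
                   (\<exists>j\<in>{1..N}. \<forall>t\<in>S. lojasiewicz_exponent R (b t) (a t) = \<alpha> j t / \<beta> j t)))
         \<and> (\<forall>j\<in>{1..N}. openin T {t \<in> topspace T. max_set R N v (a t) (b t) = {j}})"
proof -
  define r where "r i t = \<alpha> i t / \<beta> i t" for i t
  define M where "M t = max_set R N v (a t) (b t)" for t
  define L where "L t = lojasiewicz_exponent R (b t) (a t)" for t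
  \<comment> \<open>Folding the filtration values into \<open>\<alpha>\<close> and
    \<open>\<beta>\<close> removes the valuations; what remains concerns the real-valued ratios
    \<open>r i\<close> on \<open>T\<close>.\<close>
  have M: "M t = argmax_set {1..N} (\<lambda>i. r i t)" for t
    by (simp add: M_def max_set_def argmax_set_def r_def assms(7,8))
  have L: "L t = (MAX i\<in>{1..N}. r i t)" if "t \<in> topspace T" for t
    using assms(11)[OF that] by (simp add: L_def r_def)
  have r: "continuous_map T euclidean (r i)" if i: "i \<in> {1..N}" for i
    unfolding r_def
  proof (rule continuous_map_divide_ereal)
    fix t assume t: "t \<in> topspace T"
    show "\<bar>\<alpha> i t\<bar> \<noteq> \<infinity>" "\<beta> i t \<noteq> 0"
      using assms(9,10)[OF i t] by auto
  qed (use assms(12,13) i in auto)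
  let ?S = "\<lambda>J. {t \<in> topspace T. M t = J}"
  let ?P = "?S ` M ` topspace T"
  \<comment> \<open>There are at most as many strata as subsets of \<open>{1..N}\<close>.\<close>
  have "M ` topspace T \<subseteq> Pow {1..N}"
    by (auto simp: M argmax_set_def)
  then have "finite (M ` topspace T)"
    by (rule finite_subset) simp
  then have "finite ?P"
    by (rule finite_imageI)
  moreover have "partition_on (topspace T) ?P"
    by (rule partition_on_fibers)
  moreover have "locally_closedin T S \<and> M constant_on S \<and> (\<exists>j\<in>{1..N}. \<forall>t\<in>S. L t = r j t)"
    if "S \<in> ?P" for S
  proof -
    from that obtain s where S: "S = ?S (M s)" by auto
    \<comment> \<open>\<open>1 \<le> N\<close> makes the index set nonempty, so a maximum is
      attained.\<close>
    have ne: "M s \<noteq> {}"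
      unfolding M using assms(3) by (intro argmax_set_nonempty) auto
    have sub: "M s \<subseteq> {1..N}"
      by (auto simp: M argmax_set_def)
    \<comment> \<open>A maximizer at the one point \<open>s\<close> serves the whole stratum,
      because \<open>M\<close> equals \<open>M s\<close> there.\<close>
    from ne obtain j where j: "j \<in> M s" by auto
    have "L t = r j t" if "t \<in> S" for t
    proof -
      from that j S have "j \<in> argmax_set {1..N} (\<lambda>i. r i t)" unfolding M[symmetric] by simp
      with that S L[of t] show ?thesis by (auto simp: argmax_set_def)
    qed
    moreover have "locally_closedin T S"
      using locally_closedin_argmax_set_eq[of "{1..N}" T r, OF _ r sub ne] S by (simp add: M)
    moreover have "M constant_on S"
      by (auto simp: constant_on_def S)
    ultimately show ?thesis
      using j sub by blast
  qed
  moreover have "openin T (?S {j})" if "j \<in> {1..N}" for j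
    unfolding M using that r by (intro openin_argmax_set_eq_singleton) auto
  ultimately show ?thesis
    unfolding M_def L_def r_def by (intro conjI exI[of _ ?P]) (auto simp: M_def)
qed

end
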